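(* Let $r\ge1$ be an integer and $G=(X\,\dot\cup\,Y,E)$ a finite bipartite graph. (a) There is a polynomial-time algorithm that, given $G$, finds an envy-free $r$-star matching in $G$ with the maximum number of stars among all envy-free $r$-star matchings of $G$. (b) If $|N_G(X)|\ge r|X|\ge1$, then $G$ contains a nonempty envy-free $r$-star matching.
   Context: An $r$-star matching in $G$ is a set of vertex-disjoint copies of the star $K_{1,r}$ in $G$, each with its center in $X$ and its $r$ leaves in $Y$. It is \emph{envy-free} if every vertex of $X$ that is not the center of a star is non-adjacent to every vertex of $Y$ that is a leaf of a star. $N_G(X)$ denotes the set of vertices of $Y$ adjacent to some vertex of $X$. *)

theory Defs
  imports "HOL-Computational_Algebra.Polynomial"
begin

section \<open>Bipartite graphs and envy-free star matchings\<close>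

definition bipartite_graph :: "'a set \<Rightarrow> 'a set \<Rightarrow> 'a set set \<Rightarrow> bool" where
  "bipartite_graph X Y E \<longleftrightarrow>
     finite X \<and> finite Y \<and> X \<inter> Y = {} \<and> E \<subseteq> {{x, y} | x y. x \<in> X \<and> y \<in> Y}"

definition nbhd :: "'a set \<Rightarrow> 'a set set \<Rightarrow> 'a set \<Rightarrow> 'a set" where
  "nbhd Y E S = {y \<in> Y. \<exists>x\<in>S. {x, y} \<in> E}"

text \<open>A star is represented by the pair of its center and its set of leaves.\<close>

type_synonym 'a star = "'a \<times> 'a set"

definition is_star :: "nat \<Rightarrow> 'a set \<Rightarrow> 'a set \<Rightarrow> 'a set set \<Rightarrow> 'a star \<Rightarrow> bool" where
  "is_star r X Y E s \<longleftrightarrow>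
     fst s \<in> X \<and> snd s \<subseteq> Y \<and> card (snd s) = r \<and> (\<forall>y\<in>snd s. {fst s, y} \<in> E)"

definition star_verts :: "'a star \<Rightarrow> 'a set" where
  "star_verts s = insert (fst s) (snd s)"

definition star_matching ::
    "nat \<Rightarrow> 'a set \<Rightarrow> 'a set \<Rightarrow> 'a set set \<Rightarrow> 'a star set \<Rightarrow> bool" where
  "star_matching r X Y E M \<longleftrightarrow>
     (\<forall>s\<in>M. is_star r X Y E s) \<and> pairwise (\<lambda>s t. star_verts s \<inter> star_verts t = {}) M"

definition centers :: "'a star set \<Rightarrow> 'a set" where
  "centers M = fst ` M"

definition leaves :: "'a star set \<Rightarrow> 'a set" where
  "leaves M = \<Union> (snd ` M)"

definition envy_free_star_matching ::
    "nat \<Rightarrow> 'a set \<Rightarrow> 'a set \<Rightarrow> 'a set set \<Rightarrow> 'a star set \<Rightarrow> bool" where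
  "envy_free_star_matching r X Y E M \<longleftrightarrow>
     star_matching r X Y E M \<and> (\<forall>x\<in>X - centers M. \<forall>y\<in>leaves M. {x, y} \<notin> E)"

definition maximum_envy_free_star_matching ::
    "nat \<Rightarrow> 'a set \<Rightarrow> 'a set \<Rightarrow> 'a set set \<Rightarrow> 'a star set \<Rightarrow> bool" where
  "maximum_envy_free_star_matching r X Y E M \<longleftrightarrow>
     envy_free_star_matching r X Y E M \<and>
     (\<forall>M'. envy_free_star_matching r X Y E M' \<longrightarrow> card M' \<le> card M)"


section \<open>Polynomial time\<close>

text \<open>
  The machine model is a random access machine presented as a while language: finitely many
  scalar variables and one-dimensional arrays (both named by numerals occurring in the
  program), all holding natural numbers, with constants, addition and truncated subtraction
  as the only arithmetic. Every assignment and every test costs one time unit. There is no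
  multiplication, and the expressions in a fixed program have bounded size, so
  the numbers (and addresses) arising in \<open>t\<close> steps have \<open>O(t + log n)\<close> bits on
  inputs of length \<open>n\<close>; hence polynomial time in this model coincides with
  polynomial time on Turing machines.
\<close>

datatype aexp =
    Const nat
  | Var nat
  | Read nat aexp
  | Add aexp aexp
  | Sub aexp aexp

datatype com =
    Skip
  | Assign nat aexp
  | Store nat aexp aexp
  | Seq com com
  | Cond aexp com com
  | While aexp com

type_synonym state = "(nat \<Rightarrow> nat) \<times> (nat \<Rightarrow> nat \<Rightarrow> nat)"

fun aval :: "aexp \<Rightarrow> state \<Rightarrow> nat" where
  "aval (Const k) s = k"
| "aval (Var x) s = fst s x"
| "aval (Read a e) s = snd s a (aval e s)"
| "aval (Add e1 e2) s = aval e1 s + aval e2 s"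
| "aval (Sub e1 e2) s = aval e1 s - aval e2 s"

text \<open>
  \<open>exec c s t s'\<close>: started in \<open>s\<close>, program \<open>c\<close> halts in \<open>s'\<close> after \<open>t\<close> time units.
  A test succeeds iff its value is nonzero.
\<close>

inductive exec :: "com \<Rightarrow> state \<Rightarrow> nat \<Rightarrow> state \<Rightarrow> bool" where
  Skip: "exec Skip s 1 s"
| Assign: "exec (Assign x e) s 1 ((fst s)(x := aval e s), snd s)"
| Store: "exec (Store a e1 e2) s 1
            (fst s, (snd s)(a := (snd s a)(aval e1 s := aval e2 s)))"
| Seq: "exec c1 s1 t1 s2 \<Longrightarrow> exec c2 s2 t2 s3 \<Longrightarrow> exec (Seq c1 c2) s1 (t1 + t2) s3"
| CondTrue: "aval e s \<noteq> 0 \<Longrightarrow> exec c1 s t s' \<Longrightarrow> exec (Cond e c1 c2) s (t + 1) s'"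
| CondFalse: "aval e s = 0 \<Longrightarrow> exec c2 s t s' \<Longrightarrow> exec (Cond e c1 c2) s (t + 1) s'"
| WhileFalse: "aval e s = 0 \<Longrightarrow> exec (While e c) s 1 s"
| WhileTrue: "aval e s1 \<noteq> 0 \<Longrightarrow> exec c s1 t1 s2 \<Longrightarrow> exec (While e c) s2 t2 s3 \<Longrightarrow>
                exec (While e c) s1 (t1 + t2 + 1) s3"

text \<open>
  Input and output are bit strings: the length is in variable 0 and the bits are in array 0.
  All other cells are initially 0.
\<close>

definition input_state :: "bool list \<Rightarrow> state" where
  "input_state w =
     ((\<lambda>_. 0)(0 := length w),
      (\<lambda>_ _. 0)(0 := (\<lambda>i. if i < length w \<and> w ! i then 1 else 0)))"

definition output_of :: "state \<Rightarrow> bool list" where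
  "output_of s = map (\<lambda>i. snd s 0 i \<noteq> 0) [0..<fst s 0]"

text \<open>
  The output length is charged as well: repeated doubling of variable 0 could otherwise
  produce an exponentially long output in polynomially many steps.
\<close>

definition polytime :: "(bool list \<Rightarrow> bool list) \<Rightarrow> bool" where
  "polytime f \<longleftrightarrow>
     (\<exists>(c :: com) (p :: nat poly). \<forall>w. \<exists>t s.
        exec c (input_state w) t s \<and> output_of s = f w \<and>
        t + length (f w) \<le> poly p (length w))"


section \<open>Encoding graphs and star matchings as bit strings\<close>

text \<open>
  The two sides are presented by enumerations \<open>xs\<close> and \<open>ys\<close>. A graph is encoded by both sizes
  in unary, each closed by a \<open>False\<close>, and the bipartite adjacency matrix in row-major order.
  A star matching is encoded by the matrix of its edges; for \<open>r \<ge> 1\<close> this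
  determines an \<open>r\<close>-star matching, the stars being the nonzero rows.
\<close>

definition matrix_bits :: "'a list \<Rightarrow> 'a list \<Rightarrow> ('a \<Rightarrow> 'a \<Rightarrow> bool) \<Rightarrow> bool list" where
  "matrix_bits xs ys R = concat (map (\<lambda>x. map (\<lambda>y. R x y) ys) xs)"

definition encode_graph :: "'a list \<Rightarrow> 'a list \<Rightarrow> 'a set set \<Rightarrow> bool list" where
  "encode_graph xs ys E =
     replicate (length xs) True @ [False] @ replicate (length ys) True @ [False] @
     matrix_bits xs ys (\<lambda>x y. {x, y} \<in> E)"

definition encode_stars :: "'a list \<Rightarrow> 'a list \<Rightarrow> 'a star set \<Rightarrow> bool list" where
  "encode_stars xs ys M = matrix_bits xs ys (\<lambda>x y. \<exists>L. (x, L) \<in> M \<and> y \<in> L)"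

end

theory Submission imports Defs begin

text \<open>
  Assign right vertices to left vertices, at most \<open>r\<close> to each, so that the least set \<open>Z\<close> of left
  vertices which contains all deficient ones (with fewer than \<open>r\<close> leaves) and all owners of
  neighbours of its members has no unowned neighbour. Then the stars centered outside \<open>Z\<close> are
  envy-free, and counting \<open>N(Z)\<close> shows that no envy-free star matching has a center in \<open>Z\<close>,
  so they are maximum. If \<open>|N(X)| \<ge> r|X|\<close> and \<open>Z = X\<close>, counting \<open>N(X)\<close> shows that no vertex is
  deficient, hence \<open>Z\<close> is empty.

  Such an assignment is found by an auction: a deficient left vertex takes a cheapest neighbour
  from its owner (possibly itself) and raises the price by one, until all neighbours of deficient
  vertices cost more than \<open>|X|\<close>. Since an owned vertex is at most one dearer than any
  neighbour of its owner, a price level that does not occur separates a closed set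
  from the rest.
\<close>

section \<open>Optimality of the stars outside the least closed set\<close>

text \<open>As the leaf sets are disjoint, the inclusion in \<open>Z_closed\<close> and
  \<open>Z_least\<close> says two things at once: every neighbour of the set is owned, and its owner
  lies in the set. Minimality is demanded only among subsets of \<open>Z\<close>.\<close>

locale assignment =
  fixes r :: nat and X Y :: "'a set" and E :: "'a set set" and L :: "'a \<Rightarrow> 'a set" and Z :: "'a set"
  assumes graph: "bipartite_graph X Y E"
    and L_nbhd: "x \<in> X \<Longrightarrow> L x \<subseteq> nbhd Y E {x}"
    and L_card: "x \<in> X \<Longrightarrow> card (L x) \<le> r"
    and L_disjoint: "x \<in> X \<Longrightarrow> x' \<in> X \<Longrightarrow> x \<noteq> x' \<Longrightarrow> L x \<inter> L x' = {}"
    and Z_sub: "Z \<subseteq> X"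
    and Z_deficient: "x \<in> X \<Longrightarrow> card (L x) < r \<Longrightarrow> x \<in> Z"
    and Z_closed: "nbhd Y E Z \<subseteq> \<Union> (L ` Z)"
    and Z_least: "W \<subseteq> Z \<Longrightarrow> (\<And>x. x \<in> Z \<Longrightarrow> card (L x) < r \<Longrightarrow> x \<in> W) \<Longrightarrow>
                    nbhd Y E W \<subseteq> \<Union> (L ` W) \<Longrightarrow> W = Z"
begin

definition stars :: "'a star set" where
  "stars = (\<lambda>x. (x, L x)) ` (X - Z)"

lemma finite_X: "finite X" and finite_Y: "finite Y" and X_Y: "X \<inter> Y = {}"
  using graph by (auto simp: bipartite_graph_def)

lemma L_sub_Y: "x \<in> X \<Longrightarrow> L x \<subseteq> Y"
  using L_nbhd by (auto simp: nbhd_def)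

lemma finite_L: "x \<in> X \<Longrightarrow> finite (L x)"
  using L_sub_Y finite_Y finite_subset by blast

lemma finite_nbhd: "finite (nbhd Y E S)"
  using finite_Y by (simp add: nbhd_def)

lemma card_UN_L: "W \<subseteq> X \<Longrightarrow> card (\<Union> (L ` W)) = (\<Sum>x\<in>W. card (L x))"
  using finite_X L_disjoint finite_L
  by (intro card_UN_disjoint ballI impI) (meson finite_subset subsetD)+

lemma UN_L_sub_nbhd: "W \<subseteq> X \<Longrightarrow> \<Union> (L ` W) \<subseteq> nbhd Y E W"
  using L_nbhd by (fastforce simp: nbhd_def)

lemma stars_envy_free: "envy_free_star_matching r X Y E stars"
proof -
  have "is_star r X Y E (x, L x)" if "x \<in> X - Z" for x
  proof -
    have "card (L x) = r" using that L_card[of x] Z_deficient[of x] by fastforce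
    then show ?thesis using that L_nbhd[of x] by (auto simp: is_star_def nbhd_def)
  qed
  moreover have "pairwise (\<lambda>s t. star_verts s \<inter> star_verts t = {}) stars"
    unfolding pairwise_def stars_def star_verts_def
    using L_disjoint L_sub_Y X_Y by fastforce
  moreover have "{x, y} \<notin> E" if "x \<in> X - centers stars" "y \<in> leaves stars" for x y
  proof
    assume "{x, y} \<in> E"
    from that obtain x' where x': "x' \<in> X - Z" "y \<in> L x'" and x: "x \<in> Z"
      by (auto simp: stars_def centers_def leaves_def image_image)
    from x' L_sub_Y have "y \<in> Y" by blast
    with x \<open>{x, y} \<in> E\<close> have "y \<in> nbhd Y E Z" by (auto simp: nbhd_def)
    then obtain z where "z \<in> Z" "y \<in> L z" using Z_closed by blast
    with x' L_disjoint[of x' z] Z_sub show False by blast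
  qed
  ultimately show ?thesis
    unfolding envy_free_star_matching_def star_matching_def by (auto simp: stars_def)
qed

text \<open>
  Removing the centers \<open>C\<close> of a competitor from \<open>Z\<close> loses at least \<open>r\<close> neighbours per center,
  which forces equality in all counts, so that \<open>Z - C\<close> is still closed and equals \<open>Z\<close>.
\<close>

lemma centers_disjoint_Z:
  assumes M: "envy_free_star_matching r X Y E M"
  shows "centers M \<inter> Z = {}"
proof -
  have star: "\<And>s. s \<in> M \<Longrightarrow> is_star r X Y E s"
    and disj: "pairwise (\<lambda>s t. star_verts s \<inter> star_verts t = {}) M"
    and envy: "\<And>x y. x \<in> X - centers M \<Longrightarrow> y \<in> leaves M \<Longrightarrow> {x, y} \<notin> E"
    using M by (auto simp: envy_free_star_matching_def star_matching_def)
  define W where "W = Z - centers M"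
  define D where "D = Z \<inter> centers M"
  define N where "N = {s \<in> M. fst s \<in> D}"
  have fin: "finite Z" "finite W" "finite D"
    using finite_X Z_sub finite_subset by (auto simp: W_def D_def)
  have inj: "inj_on fst M"
    using disj by (force simp: inj_on_def pairwise_def star_verts_def)
  have fstN: "fst ` N = D" by (auto simp: N_def D_def centers_def image_iff)
  then have cardN: "card N = card D" and finN: "finite N"
    using inj fin by (metis (no_types, lifting) N_def card_image inj_on_subset mem_Collect_eq subsetI,
      metis (no_types, lifting) N_def finite_imageD inj_on_subset mem_Collect_eq subsetI)
  have finS: "finite (snd s)" if "s \<in> N" for s
    using star[of s] that finite_Y finite_subset by (auto simp: N_def is_star_def)
  have "card (\<Union> (snd ` N)) = (\<Sum>s\<in>N. card (snd s))"
    using finN finS disj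
    by (intro card_UN_disjoint ballI impI) (auto simp: pairwise_def star_verts_def N_def)
  also have "\<dots> = (\<Sum>s\<in>N. r)"
    using star by (intro sum.cong) (auto simp: N_def is_star_def)
  finally have cardU: "card (\<Union> (snd ` N)) = r * card D" by (simp add: cardN)
  have U_sub: "\<Union> (snd ` N) \<subseteq> nbhd Y E Z"
    using star by (fastforce simp: N_def D_def is_star_def nbhd_def)
  \<comment> \<open>A member of \<open>W\<close> is not a center of \<open>M\<close>, so
    envy-freeness separates it from every leaf of \<open>M\<close>.\<close>
  have U_W: "\<Union> (snd ` N) \<inter> nbhd Y E W = {}"
    using envy Z_sub by (fastforce simp: N_def W_def nbhd_def leaves_def)
  have W_sub: "nbhd Y E W \<subseteq> nbhd Y E Z" by (auto simp: W_def nbhd_def)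
  have "r * card D + card (nbhd Y E W) = card (\<Union> (snd ` N) \<union> nbhd Y E W)"
    using U_W cardU finite_nbhd finite_subset[OF U_sub finite_nbhd] by (simp add: card_Un_disjoint)
  also have "\<dots> \<le> card (nbhd Y E Z)"
    using U_sub W_sub finite_nbhd by (intro card_mono) auto
  also have "\<dots> \<le> card (\<Union> (L ` Z))"
    using Z_closed UN_L_sub_nbhd[OF Z_sub] finite_nbhd by (metis order_refl subset_antisym)
  also have "\<dots> = (\<Sum>x\<in>Z. card (L x))" using card_UN_L Z_sub by simp
  also have "\<dots> = (\<Sum>x\<in>W. card (L x)) + (\<Sum>x\<in>D. card (L x))"
    using fin by (subst sum.union_disjoint[symmetric]) (auto simp: W_def D_def intro!: sum.cong)
  finally have le: "r * card D + card (nbhd Y E W) \<le> (\<Sum>x\<in>W. card (L x)) + (\<Sum>x\<in>D. card (L x))" .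
  have W_X: "W \<subseteq> X" and D_X: "D \<subseteq> X" using Z_sub by (auto simp: W_def D_def)
  have eqW: "card (\<Union> (L ` W)) = (\<Sum>x\<in>W. card (L x))" by (rule card_UN_L[OF W_X])
  have leW: "card (\<Union> (L ` W)) \<le> card (nbhd Y E W)"
    using UN_L_sub_nbhd[OF W_X] finite_nbhd by (rule card_mono[rotated])
  have leD: "(\<Sum>x\<in>D. card (L x)) \<le> (\<Sum>x\<in>D. r)"
    using D_X L_card by (intro sum_mono) auto
  \<comment> \<open>A deficient vertex in \<open>D\<close> would push the leaf count over
    \<open>D\<close> strictly below \<open>r * card D\<close>, against \<open>le\<close> and
    \<open>leW\<close>.\<close>
  have D_full: "card (L x) = r" if "x \<in> D" for x
  proof (rule ccontr)
    assume "card (L x) \<noteq> r"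
    then have "(\<Sum>x\<in>D. card (L x)) < (\<Sum>x\<in>D. r)"
      using D_X L_card that fin by (intro sum_strict_mono_ex1) (auto simp: order.order_iff_strict)
    with le eqW leW show False by (simp add: mult.commute)
  qed
  have "nbhd Y E W = \<Union> (L ` W)"
    using le leD leW eqW UN_L_sub_nbhd[OF W_X] finite_nbhd
    by (intro card_subset_eq[symmetric]) (auto simp: mult.commute)
  \<comment> \<open>As all members of \<open>D\<close> are full, the deficient vertices of
    \<open>Z\<close> lie in \<open>W\<close>; the equality just shown makes \<open>W\<close> closed,
    so minimality of \<open>Z\<close> applies.\<close>
  then have "W = Z"
    using D_full by (intro Z_least) (fastforce simp: W_def D_def)+
  then show ?thesis by (auto simp: W_def)
qed

lemma stars_maximum: "maximum_envy_free_star_matching r X Y E stars"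
proof -
  have "card M \<le> card stars" if M: "envy_free_star_matching r X Y E M" for M
  proof -
    have "inj_on fst M"
      using M by (force simp: envy_free_star_matching_def star_matching_def inj_on_def pairwise_def
        star_verts_def)
    then have "card M = card (centers M)" by (simp add: centers_def card_image)
    also have "\<dots> \<le> card (X - Z)"
      using M centers_disjoint_Z[OF M] finite_X
      by (intro card_mono) (auto simp: envy_free_star_matching_def star_matching_def is_star_def
        centers_def)
    also have "\<dots> = card stars" by (simp add: stars_def card_image inj_on_def)
    finally show ?thesis .
  qed
  then show ?thesis using stars_envy_free by (auto simp: maximum_envy_free_star_matching_def)
qed

lemma stars_nonempty:
  assumes "r * card X \<le> card (nbhd Y E X)" and "1 \<le> r * card X"
  shows "stars \<noteq> {}"
proof
  assume "stars = {}"
  then have Z: "Z = X" using Z_sub by (auto simp: stars_def)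
  have full: "card (L x) = r" if "x \<in> X" for x
  proof (rule ccontr)
    assume "card (L x) \<noteq> r"
    then have "(\<Sum>x\<in>X. card (L x)) < (\<Sum>x\<in>X. r)"
      using L_card that finite_X by (intro sum_strict_mono_ex1) (auto simp: order.order_iff_strict)
    moreover have "card (nbhd Y E X) \<le> card (\<Union> (L ` X))"
      using Z_closed Z finite_X finite_L by (intro card_mono) auto
    ultimately show False using assms card_UN_L[of X] by (simp add: mult.commute)
  qed
  \<comment> \<open>Without deficient vertices the empty set already meets all closure
    conditions.\<close>
  then have "{} = Z" using Z by (intro Z_least) (auto simp: nbhd_def)
  with Z assms show False by simp
qed

end


section \<open>Running programs with a time bound\<close>

fun loop_free :: "com \<Rightarrow> bool" where
  "loop_free (Seq c1 c2) \<longleftrightarrow> loop_free c1 \<and> loop_free c2"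
| "loop_free (Cond e c1 c2) \<longleftrightarrow> loop_free c1 \<and> loop_free c2"
| "loop_free (While e c) \<longleftrightarrow> False"
| "loop_free _ \<longleftrightarrow> True"

text \<open>Lets the simplifier compute the effect of a loop body. Only the values on loop-free
  programs matter; the one on \<open>While\<close> is a dummy.\<close>

fun sem :: "com \<Rightarrow> state \<Rightarrow> state" where
  "sem (Assign x e) s = ((fst s)(x := aval e s), snd s)"
| "sem (Store a e1 e2) s = (fst s, (snd s)(a := (snd s a)(aval e1 s := aval e2 s)))"
| "sem (Seq c1 c2) s = sem c2 (sem c1 s)"
| "sem (Cond e c1 c2) s = (if aval e s \<noteq> 0 then sem c1 s else sem c2 s)"
| "sem _ s = s"

fun cost :: "com \<Rightarrow> nat" where
  "cost (Seq c1 c2) = cost c1 + cost c2"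
| "cost (Cond e c1 c2) = max (cost c1) (cost c2) + 1"
| "cost _ = 1"

lemma exec_loop_free: "loop_free c \<Longrightarrow> \<exists>t \<le> cost c. exec c s t (sem c s)"
proof (induction c arbitrary: s)
  case (Seq c1 c2)
  then obtain t1 t2 where "t1 \<le> cost c1" "exec c1 s t1 (sem c1 s)"
    "t2 \<le> cost c2" "exec c2 (sem c1 s) t2 (sem c2 (sem c1 s))" by (meson loop_free.simps(1))
  then show ?case by (auto intro!: exI[of _ "t1 + t2"] exec.Seq)
next
  case (Cond e c1 c2)
  then obtain t1 t2 where "t1 \<le> cost c1" "exec c1 s t1 (sem c1 s)"
    "t2 \<le> cost c2" "exec c2 s t2 (sem c2 s)" by (meson loop_free.simps(2))
  then show ?case
    using exec.CondTrue[of e s c1 t1 "sem c1 s" c2] exec.CondFalse[of e s c2 t2 "sem c2 s" c1]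
    by (cases "aval e s = 0") (force intro: exI[of _ "t1 + 1"] exI[of _ "t2 + 1"])+
next
  case (While e c)
  then show ?case by simp
qed (simp_all only: cost.simps sem.simps, (blast intro: exec.Skip exec.Assign exec.Store)+)

definition runs :: "com \<Rightarrow> state \<Rightarrow> nat \<Rightarrow> (state \<Rightarrow> bool) \<Rightarrow> bool" where
  "runs c s T Q \<longleftrightarrow> (\<exists>t s'. exec c s t s' \<and> t \<le> T \<and> Q s')"

lemma runs_loop_free: "loop_free c \<Longrightarrow> cost c \<le> T \<Longrightarrow> Q (sem c s) \<Longrightarrow> runs c s T Q"
  unfolding runs_def using exec_loop_free[of c s] by (meson le_trans)

lemma runs_Seq:
  "runs c1 s T1 P \<Longrightarrow> (\<And>s'. P s' \<Longrightarrow> runs c2 s' T2 Q) \<Longrightarrow> T1 + T2 \<le> T \<Longrightarrow> runs (Seq c1 c2) s T Q"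
  unfolding runs_def by (meson exec.Seq add_mono le_trans)

text \<open>An iteration pays at most \<open>cost c\<close> plus one test and lowers the variant;
  the final \<open>+ 1\<close> is the failing test. As bodies are loop-free, the searches below are
  flattened into single loops over a scan position.\<close>

lemma runs_While:
  assumes lf: "loop_free c"
    and step: "\<And>s. I s \<Longrightarrow> aval e s \<noteq> 0 \<Longrightarrow> I (sem c s) \<and> \<mu> (sem c s) < (\<mu> s :: nat)"
    and init: "I s" and post: "\<And>s. I s \<Longrightarrow> aval e s = 0 \<Longrightarrow> Q s"
    and T: "(cost c + 1) * \<mu> s + 1 \<le> T"
  shows "runs (While e c) s T Q"
proof -
  have "runs (While e c) s ((cost c + 1) * \<mu> s + 1) Q" if "I s" for s
    using that
  proof (induction "\<mu> s" arbitrary: s rule: less_induct)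
    case less
    show ?case
    proof (cases "aval e s = 0")
      case True
      then show ?thesis using post[OF less.prems True]
        unfolding runs_def using exec.WhileFalse[OF True] by (meson le_add2)
    next
      case False
      note st = step[OF less.prems False]
      obtain t1 where t1: "t1 \<le> cost c" "exec c s t1 (sem c s)" using exec_loop_free[OF lf] by blast
      obtain t2 s' where t2: "exec (While e c) (sem c s) t2 s'"
        "t2 \<le> (cost c + 1) * \<mu> (sem c s) + 1" "Q s'"
        using less.hyps[of "sem c s"] st by (auto simp: runs_def)
      have "(cost c + 1) * (\<mu> (sem c s) + 1) \<le> (cost c + 1) * \<mu> s"
        using st by (intro mult_left_mono) auto
      then have "t1 + t2 + 1 \<le> (cost c + 1) * \<mu> s + 1"
        using t1 t2 by (simp add: algebra_simps)
      then show ?thesis unfolding runs_def using exec.WhileTrue[OF False t1(2) t2(1)] t2(3) by blast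
    qed
  qed
  from this[OF init] T show ?thesis unfolding runs_def using le_trans by blast
qed


section \<open>The price algorithm\<close>

text \<open>
  Left vertices are numbered \<open>1..m\<close>, so that \<open>ow y = 0\<close> can mean that \<open>y\<close> has no owner, and
  right vertices \<open>0..<n\<close>. The array \<open>b\<close> is the encoded graph, whose matrix starts at
  index \<open>m + n + 2\<close>.
\<close>

locale auction =
  fixes r m n :: nat and b :: "nat \<Rightarrow> nat"
begin

text \<open>Rows count from 1, so row \<open>c\<close> starts at
  \<open>m + n + 2 + (c - 1) * n\<close>, which is \<open>m + 2 + c * n\<close>.\<close>

definition adj :: "nat \<Rightarrow> nat \<Rightarrow> bool" where
  "adj c y \<longleftrightarrow> b (m + 2 + c * n + y) \<noteq> 0"

definition owned :: "(nat \<Rightarrow> nat) \<Rightarrow> nat \<Rightarrow> nat set" where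
  "owned ow c = {y. y < n \<and> ow y = c}"

inductive reach :: "(nat \<Rightarrow> nat) \<Rightarrow> nat \<Rightarrow> bool" for ow where
  deficient: "c \<in> {1..m} \<Longrightarrow> card (owned ow c) < r \<Longrightarrow> reach ow c"
| step: "reach ow c \<Longrightarrow> y < n \<Longrightarrow> adj c y \<Longrightarrow> reach ow (ow y)"

text \<open>As 0 means unowned, the last clause says that no reachable vertex has an unowned
  neighbour. The reachable vertices will form the set \<open>Z\<close>.\<close>

definition assigned :: "(nat \<Rightarrow> nat) \<Rightarrow> bool" where
  "assigned ow \<longleftrightarrow>
     (\<forall>y<n. ow y \<noteq> 0 \<longrightarrow> ow y \<le> m \<and> adj (ow y) y) \<and>
     (\<forall>c\<in>{1..m}. card (owned ow c) \<le> r) \<and>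
     (\<forall>c. reach ow c \<longrightarrow> c \<in> {1..m})"

lemma finite_owned: "finite (owned ow c)"
  by (simp add: owned_def)

text \<open>
  \<open>p\<close> holds the prices of the right vertices and \<open>h\<close> lower bounds for the prices around a left
  vertex; a deficient left vertex with \<open>h c \<le> m\<close> is active. The vertices before the scan
  position \<open>(i, j)\<close> are inactive and too expensive, respectively.
\<close>

definition push_inv ::
    "nat \<Rightarrow> nat \<Rightarrow> (nat \<Rightarrow> nat) \<Rightarrow> (nat \<Rightarrow> nat) \<Rightarrow> (nat \<Rightarrow> nat) \<Rightarrow> (nat \<Rightarrow> nat) \<Rightarrow> bool" where
  "push_inv i j h p ow d \<longleftrightarrow>
     1 \<le> i \<and> i \<le> m + 1 \<and> j \<le> n \<and>
     (\<forall>y<n. p y \<le> m + 1 \<and> (p y \<noteq> 0 \<longrightarrow> ow y \<noteq> 0) \<and>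
            (ow y \<noteq> 0 \<longrightarrow> ow y \<le> m \<and> adj (ow y) y \<and> p y \<le> h (ow y) + 1)) \<and>
     (\<forall>c\<in>{1..m}. h c \<le> m + 1 \<and> d c = card (owned ow c) \<and> d c \<le> r \<and>
            (h c = m + 1 \<longrightarrow> d c < r) \<and> (\<forall>y<n. adj c y \<longrightarrow> h c \<le> p y)) \<and>
     (\<forall>c\<in>{1..<i}. d c = r \<or> h c = m + 1) \<and>
     (\<forall>y<j. adj i y \<longrightarrow> h i < p y)"

lemma push_inv_bounds: "push_inv i j h p ow d \<Longrightarrow> 1 \<le> i \<and> i \<le> m + 1 \<and> j \<le> n"
  by (simp add: push_inv_def)

lemma push_inv_left:
  assumes "push_inv i j h p ow d" and "c \<in> {1..m}"
  shows "h c \<le> m + 1" and "d c = card (owned ow c)" and "d c \<le> r"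
    and "h c = m + 1 \<Longrightarrow> d c < r" and "y < n \<Longrightarrow> adj c y \<Longrightarrow> h c \<le> p y"
    and "c < i \<Longrightarrow> d c = r \<or> h c = m + 1"
proof -
  show "h c \<le> m + 1" and "d c = card (owned ow c)" and "d c \<le> r"
    and "h c = m + 1 \<Longrightarrow> d c < r" and "y < n \<Longrightarrow> adj c y \<Longrightarrow> h c \<le> p y"
    using assms unfolding push_inv_def by blast+
  show "d c = r \<or> h c = m + 1" if "c < i"
    using assms that unfolding push_inv_def by (meson atLeastAtMost_iff atLeastLessThan_iff)
qed

section \<open>Potentials bounding the number of iterations\<close>

definition room :: "(nat \<Rightarrow> nat) \<Rightarrow> nat set \<Rightarrow> nat" where
  "room g S = (\<Sum>x\<in>S. m + 1 - g x)"

text \<open>Flattens the lexicographic order on \<open>(q, m + 1 - i, n - j)\<close> into one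
  number: a drop of the potential \<open>q\<close> outweighs a return of the scan to
  \<open>(1, 0)\<close>, and a new row outweighs the reset of \<open>j\<close>.\<close>

definition steps_left :: "nat \<Rightarrow> nat \<Rightarrow> nat \<Rightarrow> nat" where
  "steps_left q i j = (q * (m + 1) + (m + 1 - i)) * (n + 1) + (n - j)"

lemma room_upd_less:
  "finite S \<Longrightarrow> x \<in> S \<Longrightarrow> g x \<le> m \<Longrightarrow> g x < v \<Longrightarrow> room (g(x := v)) S < room g S"
  unfolding room_def by (rule sum_strict_mono_ex1) auto

lemma room_le: "room g S \<le> card S * (m + 1)"
  unfolding room_def by (rule order_trans[OF sum_bounded_above[of _ _ "m + 1"]]) auto

lemma steps_left_reset: "q' < q \<Longrightarrow> steps_left q' 1 0 < steps_left q i j"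
proof -
  assume "q' < q"
  then have "(q' + 1) * (m + 1) \<le> q * (m + 1)" by (intro mult_right_mono) auto
  then have "q' * (m + 1) + m + 1 \<le> q * (m + 1) + (m + 1 - i)" by simp
  then have "(q' * (m + 1) + m + 1) * (n + 1) \<le> (q * (m + 1) + (m + 1 - i)) * (n + 1)"
    by (rule mult_right_mono) simp
  then show ?thesis by (simp add: steps_left_def algebra_simps)
qed

lemma steps_left_next_row: "i \<le> m \<Longrightarrow> steps_left q (i + 1) 0 < steps_left q i j"
proof -
  assume "i \<le> m"
  then have "m + 1 - i = (m + 1 - (i + 1)) + 1" by simp
  then show ?thesis unfolding steps_left_def by (simp add: algebra_simps)
qed

lemma steps_left_next: "j < n \<Longrightarrow> steps_left q i (j + 1) < steps_left q i j"
  by (simp add: steps_left_def)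

lemma steps_left_le:
  "q \<le> (m + n) * (m + 1) \<Longrightarrow> steps_left q 1 0 \<le> ((m + n) * (m + 1) * (m + 1) + m) * (n + 1) + n"
  unfolding steps_left_def by (intro add_mono mult_right_mono) simp_all

lemma owned_upd:
  "owned (ow(j := i)) c = (if c = i \<and> j < n then insert j (owned ow c) else owned ow c - {j})"
  by (auto simp: owned_def)

text \<open>The lower bound forces \<open>p j = h i\<close>, so the new price is exactly
  \<open>h i + 1\<close>, as allowed for the new owner \<open>i\<close>. The previous owner may
  become deficient, hence the scan restarts. Decrementing before incrementing keeps the count right
  when \<open>i\<close> already owns \<open>j\<close>.\<close>

lemma push_inv_push:
  assumes inv: "push_inv i j h p ow d" and i: "i \<le> m" and d: "d i < r" and h: "h i \<le> m"
    and j: "j < n" and a: "adj i j" and p: "p j \<le> h i" and d1: "d1 = d(ow j := d (ow j) - 1)"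
  shows "push_inv 1 0 h (p(j := p j + 1)) (ow(j := i)) (d1(i := d1 i + 1))"
proof -
  have i1: "i \<in> {1..m}" using inv i by (auto simp: push_inv_def)
  note deg = push_inv_left(2)[OF inv]
  have pj: "p j = h i" using push_inv_left(5)[OF inv i1 j a] p by simp
  have deg': "(d1(i := d1 i + 1)) c = card (owned (ow(j := i)) c)" if c: "c \<in> {1..m}" for c
  proof (cases "ow j = c")
    case True
    then have jin: "j \<in> owned ow c" using j by (simp add: owned_def)
    then have "card (owned ow c) > 0" by (auto simp: card_gt_0_iff finite_owned)
    then show ?thesis
      using True j jin deg[OF c] d1
      by (cases "c = i") (auto simp: owned_upd insert_absorb finite_owned)
  next
    case False
    then have "j \<notin> owned ow c" by (simp add: owned_def)
    then show ?thesis using False j deg[OF c] d1 by (auto simp: owned_upd finite_owned)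
  qed
  have le: "(d1(i := d1 i + 1)) c \<le> (if c = i then d i + 1 else d c)" for c using d1 by auto
  have "(d1(i := d1 i + 1)) c \<le> r \<and> (h c = m + 1 \<longrightarrow> (d1(i := d1 i + 1)) c < r)"
    if "c \<in> {1..m}" for c
    using le[of c] push_inv_left(3,4)[OF inv that] d h by (auto split: if_splits)
  moreover have "\<forall>y<n. adj c y \<longrightarrow> h c \<le> (p(j := p j + 1)) y" if "c \<in> {1..m}" for c
    using inv that by (auto simp: push_inv_def le_SucI)
  ultimately show ?thesis
    using inv deg' i1 a pj h unfolding push_inv_def
    by (auto simp del: fun_upd_apply simp: fun_upd_apply[of p] fun_upd_apply[of ow])
qed

text \<open>The whole row has been scanned, so all neighbours of \<open>i\<close> cost more than
  \<open>h i\<close> and the raised bound still holds; the upper bounds on the prices of what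
  \<open>i\<close> owns only get weaker.\<close>

lemma push_inv_raise:
  assumes inv: "push_inv i n h p ow d" and i: "i \<le> m" and d: "d i < r" and h: "h i \<le> m"
  shows "push_inv 1 0 (h(i := h i + 1)) p ow d"
  using assms unfolding push_inv_def by (auto simp: Suc_le_eq le_SucI)

lemma push_inv_next:
  assumes "push_inv i j h p ow d" and "j < n" and "adj i j \<Longrightarrow> h i < p j"
  shows "push_inv i (j + 1) h p ow d"
  using assms unfolding push_inv_def by (auto simp: less_Suc_eq)

lemma push_inv_next_row:
  assumes inv: "push_inv i j h p ow d" and i: "i \<le> m" and inactive: "r \<le> d i \<or> m < h i"
  shows "push_inv (i + 1) 0 h p ow d"
proof -
  have "i \<in> {1..m}" using inv i by (auto simp: push_inv_def)
  then have "d i \<le> r \<and> h i \<le> m + 1" using push_inv_left(1,3)[OF inv] by simp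
  with inactive have "d i = r \<or> h i = m + 1" by auto
  with inv i show ?thesis unfolding push_inv_def by (auto simp: less_Suc_eq)
qed

text \<open>
  As only \<open>m\<close> values of \<open>h\<close> occur among \<open>0..m\<close>, one value \<open>k\<close> is missing. The left
  vertices above \<open>k\<close> form a closed set containing all deficient ones, hence all reachable ones.
\<close>

lemma push_inv_assigned:
  assumes inv: "push_inv (m + 1) j h p ow d"
  shows "assigned ow"
proof -
  have "\<not> {0..m} \<subseteq> h ` {1..m}"
  proof
    assume "{0..m} \<subseteq> h ` {1..m}"
    then have "card {0..m} \<le> card {1..m}" by (rule surj_card_le[rotated]) simp
    then show False by simp
  qed
  then obtain k where "k \<in> {0..m}" "k \<notin> h ` {1..m}" by blast
  then have k: "k \<le> m" "\<And>c. c \<in> {1..m} \<Longrightarrow> h c \<noteq> k" by auto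
  have "c \<in> {1..m} \<and> k < h c" if "reach ow c" for c
    using that
  proof induction
    case (deficient c)
    then have "h c = m + 1" using push_inv_left(2,6)[OF inv, of c] by auto
    then show ?case using deficient k by auto
  next
    case (step c y)
    \<comment> \<open>The price of \<open>y\<close> is positive, so \<open>y\<close> has an owner,
      whose \<open>h\<close> is at least \<open>p y - 1\<close> and thus at least \<open>k\<close>.
      As \<open>k\<close> does not occur, it is larger.\<close>
    then have "k < p y" using push_inv_left(5)[OF inv, of c y] by auto
    then have "ow y \<in> {1..m}" "p y \<le> h (ow y) + 1"
      using inv step by (auto simp: push_inv_def Suc_le_eq)
    then show ?case using \<open>k < p y\<close> k(2)[of "ow y"] by auto
  qed
  moreover have "card (owned ow c) \<le> r" if "c \<in> {1..m}" for c
    using push_inv_left(2,3)[OF inv that] by simp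
  moreover have "ow y \<le> m \<and> adj (ow y) y" if "y < n" "ow y \<noteq> 0" for y
    using inv that by (auto simp: push_inv_def)
  ultimately show ?thesis unfolding assigned_def by blast
qed

text \<open>
  Once no vertex is active, the left vertices with \<open>h c = m + 1\<close> are exactly the deficient ones,
  so \<open>h\<close> is reused to mark the reachable vertices.
\<close>

definition mark_inv :: "(nat \<Rightarrow> nat) \<Rightarrow> nat \<Rightarrow> nat \<Rightarrow> (nat \<Rightarrow> nat) \<Rightarrow> bool" where
  "mark_inv ow i j h \<longleftrightarrow>
     1 \<le> i \<and> i \<le> m + 1 \<and> j \<le> n \<and>
     (\<forall>c\<in>{1..m}. (m < h c \<longrightarrow> reach ow c) \<and> (card (owned ow c) < r \<longrightarrow> m < h c)) \<and>
     (\<forall>c\<in>{1..<i}. m < h c \<longrightarrow> (\<forall>y<n. adj c y \<longrightarrow> m < h (ow y))) \<and>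
     (\<forall>y<j. adj i y \<longrightarrow> m < h (ow y))"

lemma mark_inv_bounds: "mark_inv ow i j h \<Longrightarrow> 1 \<le> i \<and> i \<le> m + 1 \<and> j \<le> n"
  by (simp add: mark_inv_def)

lemma mark_inv_init:
  assumes inv: "push_inv (m + 1) j h p ow d"
  shows "mark_inv ow 1 0 h"
proof -
  have "m < h c \<longleftrightarrow> card (owned ow c) < r" if "c \<in> {1..m}" for c
    using push_inv_left(1,2,4,6)[OF inv that] that by auto
  then show ?thesis by (auto simp: mark_inv_def intro: reach.deficient)
qed

text \<open>The marked owner may belong to a row already passed as unmarked, so the scan
  restarts.\<close>

lemma mark_inv_mark:
  assumes "mark_inv ow i j h" and "i \<le> m" and "m < h i" and "j < n" and "adj i j"
  shows "mark_inv ow 1 0 (h(ow j := m + 1))"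
proof -
  have "reach ow (ow j)" using assms by (intro reach.step[of ow i]) (auto simp: mark_inv_def)
  then show ?thesis using assms unfolding mark_inv_def by auto
qed

lemma mark_inv_next:
  assumes "mark_inv ow i j h" and "j < n" and "adj i j \<Longrightarrow> m < h (ow j)"
  shows "mark_inv ow i (j + 1) h"
  using assms unfolding mark_inv_def by (auto simp: less_Suc_eq)

lemma mark_inv_next_row:
  assumes "mark_inv ow i j h" and "i \<le> m" and "m < h i \<Longrightarrow> j = n"
  shows "mark_inv ow (i + 1) 0 h"
  using assms unfolding mark_inv_def by (auto simp: less_Suc_eq)

text \<open>After a complete scan the marked vertices include the deficient ones and are closed
  under \<open>step\<close>, so induction on \<open>reach\<close> applies; the converse is kept by
  the invariant.\<close>

lemma mark_inv_reach:
  assumes inv: "mark_inv ow (m + 1) j h" and "assigned ow" and c: "c \<in> {1..m}"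
  shows "m < h c \<longleftrightarrow> reach ow c"
proof
  assume "reach ow c"
  then show "m < h c"
  proof induction
    case (step c y)
    moreover have "c \<in> {1..m}" using step \<open>assigned ow\<close> by (auto simp: assigned_def)
    ultimately show ?case using inv by (auto simp: mark_inv_def)
  qed (use inv in \<open>auto simp: mark_inv_def\<close>)
qed (use inv c in \<open>auto simp: mark_inv_def\<close>)


end


section \<open>The program\<close>

text \<open>
  Variables: 1 and 2 hold \<open>m\<close> and \<open>n\<close>, 3 and 4 the position \<open>(i, j)\<close>, 5 the address of
  row \<open>i\<close> of the matrix. Arrays: 1 to 4 hold \<open>h\<close>, \<open>p\<close>, \<open>ow\<close> and \<open>d\<close>.
\<close>

definition block :: "com list \<Rightarrow> com" where
  "block cs = foldr Seq cs Skip"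

definition incr :: "nat \<Rightarrow> com" where
  "incr x = Assign x (Add (Var x) (Const 1))"

definition restart :: com where
  "restart = block [Assign 3 (Const 1), Assign 4 (Const 0),
     Assign 5 (Add (Add (Var 1) (Const 2)) (Var 2))]"

definition next_row :: com where
  "next_row = block [incr 3, Assign 4 (Const 0), Assign 5 (Add (Var 5) (Var 2))]"

definition rows_left :: aexp where
  "rows_left = Sub (Add (Var 1) (Const 1)) (Var 3)"

text \<open>As a test, \<open>Sub a b\<close> means \<open>b < a\<close>. The count of the old owner
  is lowered before the owner is overwritten; for an unowned \<open>j\<close> this only touches cell
  0 of array 4, which belongs to no vertex.\<close>

definition push_body :: "nat \<Rightarrow> com" where
  "push_body r =
     Cond (Sub (Const r) (Read 4 (Var 3)))
       (Cond (Sub (Add (Var 1) (Const 1)) (Read 1 (Var 3)))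
         (Cond (Sub (Var 2) (Var 4))
           (Cond (Read 0 (Add (Var 5) (Var 4)))
             (Cond (Sub (Read 2 (Var 4)) (Read 1 (Var 3)))
               (incr 4)
               (block
                 [Store 4 (Read 3 (Var 4)) (Sub (Read 4 (Read 3 (Var 4))) (Const 1)),
                  Store 4 (Var 3) (Add (Read 4 (Var 3)) (Const 1)),
                  Store 3 (Var 4) (Var 3),
                  Store 2 (Var 4) (Add (Read 2 (Var 4)) (Const 1)),
                  restart]))
             (incr 4))
           (block [Store 1 (Var 3) (Add (Read 1 (Var 3)) (Const 1)), restart]))
         next_row)
       next_row"

definition mark_body :: com where
  "mark_body =
     Cond (Sub (Add (Var 1) (Const 1)) (Read 1 (Var 3)))
       next_row
       (Cond (Sub (Var 2) (Var 4))
         (Cond (Read 0 (Add (Var 5) (Var 4)))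
           (Cond (Sub (Add (Var 1) (Const 1)) (Read 1 (Read 3 (Var 4))))
             (block [Store 1 (Read 3 (Var 4)) (Add (Var 1) (Const 1)), restart])
             (incr 4))
           (incr 4))
         next_row)"

text \<open>The stored expression is 1 if \<open>ow j = i\<close> and \<open>h i \<le> m\<close>, and 0 otherwise.\<close>

definition write_body :: com where
  "write_body =
     Cond (Sub (Var 2) (Var 4))
       (block
         [Store 0 (Var 0)
            (Sub (Const 1)
              (Add (Add (Sub (Read 3 (Var 4)) (Var 3)) (Sub (Var 3) (Read 3 (Var 4))))
                   (Sub (Read 1 (Var 3)) (Var 1)))),
          incr 0, incr 4])
       next_row"

definition parse :: com where
  "parse = Seq (While (Read 0 (Var 1)) (incr 1))
     (While (Read 0 (Add (Add (Var 1) (Const 1)) (Var 2))) (incr 2))"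

text \<open>Variable 0 initially holds the input length; clearing it turns it into the write
  position and, finally, the output length.\<close>

definition solve :: "nat \<Rightarrow> com" where
  "solve r =
     Seq restart (Seq (While rows_left (push_body r))
    (Seq restart (Seq (While rows_left mark_body)
    (Seq (Assign 0 (Const 0)) (Seq restart (While rows_left write_body))))))"

lemmas program_defs = block_def incr_def restart_def next_row_def rows_left_def push_body_def
  mark_body_def write_body_def

context auction
begin

section \<open>Invariants and variants of the three loops\<close>

definition base_state :: "state \<Rightarrow> bool" where
  "base_state s \<longleftrightarrow> fst s 1 = m \<and> fst s 2 = n \<and> fst s 5 = m + 2 + fst s 3 * n"

text \<open>Bounds \<open>steps_left\<close> from position \<open>(1, 0)\<close>, where the
  potential is at most \<open>m + 1\<close> for each of the \<open>m + n\<close> vertices.\<close>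

definition max_steps :: nat where
  "max_steps = ((m + n) * (m + 1) * (m + 1) + m) * (n + 1) + n"

definition push_state :: "state \<Rightarrow> bool" where
  "push_state s \<longleftrightarrow> base_state s \<and> snd s 0 = b \<and>
     push_inv (fst s 3) (fst s 4) (snd s 1) (snd s 2) (snd s 3) (snd s 4)"

definition push_left :: "state \<Rightarrow> nat" where
  "push_left s =
     steps_left (room (snd s 1) {1..m} + room (snd s 2) {..<n}) (fst s 3) (fst s 4)"

lemma push_body_step:
  assumes I: "push_state s" and g: "aval rows_left s \<noteq> 0"
  shows "push_state (sem (push_body r) s) \<and> push_left (sem (push_body r) s) < push_left s"
proof -
  obtain v a where s: "s = (v, a)" by force
  define i j h p ow d where "i = v 3" and "j = v 4" and "h = a 1" and "p = a 2" and "ow = a 3"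
    and "d = a 4"
  note defs = this
  have inv: "push_inv i j h p ow d" and base: "base_state s" and b: "a 0 = b"
    using I by (auto simp: push_state_def s defs)
  have v: "v (Suc 0) = m" "v 2 = n" "v 5 = m + 2 + i * n" "v 3 = i" "v 4 = j" using base
    by (auto simp: base_state_def s defs)
  have arr: "a (Suc 0) = h" "a 2 = p" "a 3 = ow" "a 4 = d" by (auto simp: defs)
  have i: "i \<le> m" using g v by (auto simp: s rows_left_def)
  then have i1: "i \<in> {1..m}" using push_inv_bounds[OF inv] by auto
  have jn: "j \<le> n" using push_inv_bounds[OF inv] by auto
  note simps = s push_state_def base_state_def push_left_def program_defs b v arr
  \<comment> \<open>These are the branches of \<open>push_body\<close>; \<open>full\<close> joins
    both reasons for inactivity, and \<open>skip\<close> joins a non-neighbour with a too expensive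
    neighbour.\<close>
  consider (full) "r \<le> d i \<or> m < h i"
    | (raise) "d i < r" "h i \<le> m" "j = n"
    | (skip) "d i < r" "h i \<le> m" "j < n" "adj i j \<Longrightarrow> h i < p j"
    | (push) "d i < r" "h i \<le> m" "j < n" "adj i j" "p j \<le> h i"
    using jn by linarith
  then show ?thesis
  proof cases
    case full
    then show ?thesis
      using push_inv_next_row[OF inv i full] steps_left_next_row[OF i] by (auto simp: simps)
  next
    case raise
    have "room (h(i := Suc (h i))) {1..m} < room h {1..m}"
      using raise i1 by (intro room_upd_less) auto
    then show ?thesis
      using raise push_inv_raise[of i h p ow d] inv i
      by (auto simp: simps intro!: steps_left_reset[unfolded One_nat_def])
  next
    case skip
    then show ?thesis
      using push_inv_next[OF inv] steps_left_next[of j] by (auto simp: simps adj_def)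
  next
    case push
    have "room (p(j := Suc (p j))) {..<n} < room p {..<n}"
      using push by (intro room_upd_less) auto
    then show ?thesis
      using push push_inv_push[OF inv i push refl]
      by (auto simp: simps adj_def intro!: steps_left_reset[unfolded One_nat_def])
  qed
qed

definition mark_state :: "(nat \<Rightarrow> nat) \<Rightarrow> state \<Rightarrow> bool" where
  "mark_state ow s \<longleftrightarrow> base_state s \<and> snd s 0 = b \<and> snd s 3 = ow \<and>
     mark_inv ow (fst s 3) (fst s 4) (snd s 1)"

definition mark_left :: "state \<Rightarrow> nat" where
  "mark_left s = steps_left (room (snd s 1) {1..m}) (fst s 3) (fst s 4)"

lemma mark_body_step:
  assumes ow: "assigned ow" and I: "mark_state ow s" and g: "aval rows_left s \<noteq> 0"
  shows "mark_state ow (sem mark_body s) \<and> mark_left (sem mark_body s) < mark_left s"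
proof -
  obtain v a where s: "s = (v, a)" by force
  define i j h where "i = v 3" and "j = v 4" and "h = a 1"
  note defs = this
  have inv: "mark_inv ow i j h" and base: "base_state s" and b: "a 0 = b" and a3: "a 3 = ow"
    using I by (auto simp: mark_state_def s defs)
  have v: "v (Suc 0) = m" "v 2 = n" "v 5 = m + 2 + i * n" "v 3 = i" "v 4 = j" using base
    by (auto simp: base_state_def s defs)
  have arr: "a (Suc 0) = h" by (auto simp: defs)
  have i: "i \<le> m" using g v by (auto simp: s rows_left_def)
  then have i1: "i \<in> {1..m}" using mark_inv_bounds[OF inv] by auto
  have jn: "j \<le> n" using mark_inv_bounds[OF inv] by auto
  note simps = s mark_state_def base_state_def mark_left_def program_defs b a3 v arr
  consider (idle) "m < h i \<Longrightarrow> j = n"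
    | (skip) "m < h i" "j < n" "adj i j \<Longrightarrow> m < h (ow j)"
    | (mark) "m < h i" "j < n" "adj i j" "h (ow j) \<le> m"
    using jn by linarith
  then show ?thesis
  proof cases
    case idle
    then show ?thesis
      using mark_inv_next_row[OF inv i idle] steps_left_next_row[OF i] by (auto simp: simps)
  next
    case skip
    then show ?thesis
      using mark_inv_next[OF inv] steps_left_next[of j] by (auto simp: simps adj_def)
  next
    case mark
    \<comment> \<open>Reachability of \<open>i\<close> makes \<open>ow j\<close> a genuine left
      vertex rather than 0, so that marking it lowers the potential.\<close>
    have "reach ow i" using inv i1 mark by (auto simp: mark_inv_def)
    then have "ow j \<in> {1..m}" using ow mark by (auto simp: assigned_def dest: reach.step)
    then have "room (h(ow j := Suc m)) {1..m} < room h {1..m}"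
      using mark by (intro room_upd_less) auto
    then show ?thesis
      using mark mark_inv_mark[OF inv i mark(1-3)]
      by (auto simp: simps adj_def intro!: steps_left_reset[unfolded One_nat_def])
  qed
qed

definition result :: "(nat \<Rightarrow> nat) \<Rightarrow> nat \<Rightarrow> nat \<Rightarrow> bool" where
  "result ow c y \<longleftrightarrow> ow y = c \<and> \<not> reach ow c"

definition rows_upto :: "(nat \<Rightarrow> nat) \<Rightarrow> nat \<Rightarrow> nat \<Rightarrow> bool list" where
  "rows_upto ow i j =
     concat (map (\<lambda>c. map (result ow c) [0..<n]) [1..<i]) @ map (result ow i) [0..<j]"

text \<open>Array 0 now receives the output in place of the graph; owners and marks determine what
  to write. Beyond the last row the column must be 0, so the final output consists of complete
  rows.\<close>

definition write_state :: "(nat \<Rightarrow> nat) \<Rightarrow> state \<Rightarrow> bool" where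
  "write_state ow s \<longleftrightarrow> base_state s \<and> snd s 3 = ow \<and> 1 \<le> fst s 3 \<and> fst s 3 \<le> m + 1 \<and>
     fst s 4 \<le> n \<and> (fst s 3 = m + 1 \<longrightarrow> fst s 4 = 0) \<and>
     (\<forall>c\<in>{1..m}. m < snd s 1 c \<longleftrightarrow> reach ow c) \<and>
     output_of s = rows_upto ow (fst s 3) (fst s 4)"

definition write_left :: "state \<Rightarrow> nat" where
  "write_left s = steps_left 0 (fst s 3) (fst s 4)"

lemma write_body_step:
  assumes I: "write_state ow s" and g: "aval rows_left s \<noteq> 0"
  shows "write_state ow (sem write_body s) \<and> write_left (sem write_body s) < write_left s"
proof -
  obtain v a where s: "s = (v, a)" by force
  define i j h where "i = v 3" and "j = v 4" and "h = a 1"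
  note defs = this
  have base: "base_state s" and a3: "a 3 = ow" and i0: "1 \<le> i" and jn: "j \<le> n"
    and h: "\<And>c. c \<in> {1..m} \<Longrightarrow> m < h c \<longleftrightarrow> reach ow c"
    and out: "output_of (v, a) = rows_upto ow i j"
    using I by (auto simp: write_state_def s defs)
  have v: "v (Suc 0) = m" "v 2 = n" "v 5 = m + 2 + i * n" "v 3 = i" "v 4 = j" using base
    by (auto simp: base_state_def s defs)
  have arr: "a (Suc 0) = h" by (auto simp: defs)
  have i: "i \<le> m" using g v by (auto simp: s rows_left_def)
  note simps = s write_state_def base_state_def write_left_def program_defs a3 v arr
  show ?thesis
  proof (cases "j < n")
    case True
    have "output_of (v', a') = output_of (v, a) @ [x \<noteq> 0]"
      if "v' 0 = Suc (v 0)" "a' 0 = (a 0)(v 0 := x)" for v' a' and x :: nat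
      using that by (simp add: output_of_def)
    moreover have "rows_upto ow i (Suc j) = rows_upto ow i j @ [result ow i j]"
      by (simp add: rows_upto_def)
    moreover have "Suc 0 - (ow j - i + (i - ow j) + (h i - m)) \<noteq> 0 \<longleftrightarrow> result ow i j"
      using h[of i] i i0 by (auto simp: result_def)
    ultimately show ?thesis
      using True i i0 h steps_left_next[OF True] out by (auto simp: simps)
  next
    case False
    then have "j = n" using jn by simp
    then have "rows_upto ow (Suc i) 0 = rows_upto ow i j" using i0 by (simp add: rows_upto_def)
    moreover have "output_of (v', a) = output_of (v, a)" if "v' 0 = v 0" for v'
      using that by (simp add: output_of_def)
    ultimately show ?thesis
      using False i i0 h steps_left_next_row[OF i] out by (auto simp: simps)
  qed
qed

end

section \<open>Correctness and running time\<close>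

context auction
begin

lemma push_inv_init: "push_inv 1 0 (\<lambda>_. 0) (\<lambda>_. 0) (\<lambda>_. 0) (\<lambda>_. 0)"
  by (auto simp: push_inv_def owned_def)

lemma restart_sem: "sem restart (v, a) = (v(3 := 1, 4 := 0, 5 := v 1 + 2 + v 2), a)"
  by (auto simp: restart_def block_def)

lemma runs_restart: "Q (sem restart s) \<Longrightarrow> runs restart s 4 Q"
  by (rule runs_loop_free) (auto simp: restart_def block_def)

lemma rows_left_zero:
  "base_state s \<Longrightarrow> fst s 3 \<le> m + 1 \<Longrightarrow> aval rows_left s = 0 \<Longrightarrow> fst s 3 = m + 1"
  by (simp add: rows_left_def base_state_def)

lemma runs_push:
  assumes I: "push_state s" and ij: "fst s 3 = 1" "fst s 4 = 0"
  shows "runs (While rows_left (push_body r)) s (30 * max_steps + 1)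
    (\<lambda>s'. push_state s' \<and> fst s' 3 = m + 1)"
proof (rule runs_While[where \<mu> = push_left and I = push_state])
  have "room (snd s 1) {1..m} + room (snd s 2) {..<n} \<le> (m + n) * (m + 1)"
    using room_le[of "snd s 1" "{1..m}"] room_le[of "snd s 2" "{..<n}"] by (simp add: algebra_simps)
  then have "push_left s \<le> max_steps"
    using ij steps_left_le by (simp add: push_left_def max_steps_def)
  \<comment> \<open>30 is a generous bound, shared by all three loops.\<close>
  moreover have "cost (push_body r) + 1 \<le> 30" by (simp add: program_defs)
  ultimately have "(cost (push_body r) + 1) * push_left s \<le> 30 * max_steps"
   
   
    by (rule mult_le_mono[rotated])
  then show "(cost (push_body r) + 1) * push_left s + 1 \<le> 30 * max_steps + 1" by simp
next
  fix s assume s: "push_state s" "aval rows_left s = 0"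
  then show "push_state s \<and> fst s 3 = m + 1"
    using push_inv_bounds rows_left_zero[of s] unfolding push_state_def by blast
next
  fix s assume "push_state s" "aval rows_left s \<noteq> 0"
  then show "push_state (sem (push_body r) s) \<and> push_left (sem (push_body r) s) < push_left s"
    by (rule push_body_step)
qed (use I in \<open>simp_all add: program_defs\<close>)

lemma runs_mark:
  assumes ow: "assigned ow" and I: "mark_state ow s" and ij: "fst s 3 = 1" "fst s 4 = 0"
  shows "runs (While rows_left mark_body) s (30 * max_steps + 1)
    (\<lambda>s'. mark_state ow s' \<and> fst s' 3 = m + 1)"
proof (rule runs_While[where \<mu> = mark_left and I = "mark_state ow"])
  have "room (snd s 1) {1..m} \<le> (m + n) * (m + 1)"
    using room_le[of "snd s 1" "{1..m}"] by (simp add: algebra_simps)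
  then have "mark_left s \<le> max_steps"
    using ij steps_left_le by (simp add: mark_left_def max_steps_def)
  moreover have "cost mark_body + 1 \<le> 30" by (simp add: program_defs)
  ultimately have "(cost mark_body + 1) * mark_left s \<le> 30 * max_steps"
   
   
    by (rule mult_le_mono[rotated])
  then show "(cost mark_body + 1) * mark_left s + 1 \<le> 30 * max_steps + 1" by simp
next
  fix s assume s: "mark_state ow s" "aval rows_left s = 0"
  then show "mark_state ow s \<and> fst s 3 = m + 1"
    using mark_inv_bounds rows_left_zero[of s] unfolding mark_state_def by blast
next
  fix s assume "mark_state ow s" "aval rows_left s \<noteq> 0"
  then show "mark_state ow (sem mark_body s) \<and> mark_left (sem mark_body s) < mark_left s"
    by (rule mark_body_step[OF ow])
qed (use I in \<open>simp_all add: program_defs\<close>)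

lemma runs_write:
  assumes I: "write_state ow s" and ij: "fst s 3 = 1" "fst s 4 = 0"
  shows "runs (While rows_left write_body) s (30 * max_steps + 1)
    (\<lambda>s'. output_of s' = rows_upto ow (m + 1) 0)"
proof (rule runs_While[where \<mu> = write_left and I = "write_state ow"])
  have "write_left s \<le> max_steps"
    using ij steps_left_le by (simp add: write_left_def max_steps_def)
  moreover have "cost write_body + 1 \<le> 30" by (simp add: program_defs)
  ultimately have "(cost write_body + 1) * write_left s \<le> 30 * max_steps"
   
   
    by (rule mult_le_mono[rotated])
  then show "(cost write_body + 1) * write_left s + 1 \<le> 30 * max_steps + 1" by simp
next
  fix s assume s: "write_state ow s" "aval rows_left s = 0"
  then have "fst s 3 = m + 1" by (intro rows_left_zero) (auto simp: write_state_def)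
  with s show "output_of s = rows_upto ow (m + 1) 0" by (auto simp: write_state_def)
next
  fix s assume "write_state ow s" "aval rows_left s \<noteq> 0"
  then show "write_state ow (sem write_body s) \<and> write_left (sem write_body s) < write_left s"
    by (rule write_body_step)
qed (use I in \<open>simp_all add: program_defs\<close>)

text \<open>The 16 extra units are three restarts of cost 4, three failing loop tests and one
  assignment.\<close>

lemma runs_solve:
  assumes s: "fst s 1 = m" "fst s 2 = n" "snd s 0 = b" "\<And>k. k \<in> {1..4} \<Longrightarrow> snd s k = (\<lambda>_. 0)"
  shows "runs (solve r) s (90 * max_steps + 16)
    (\<lambda>s'. \<exists>ow. assigned ow \<and> output_of s' = rows_upto ow (m + 1) 0)"
  unfolding solve_def
proof (rule runs_Seq)
  have "push_state (sem restart s)"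
    using s push_inv_init by (cases s) (simp add: push_state_def base_state_def restart_sem)
  then show "runs restart s 4 (\<lambda>s. push_state s \<and> fst s 3 = 1 \<and> fst s 4 = 0)"
    by (cases s) (auto intro!: runs_restart simp: restart_sem)
next
  fix s assume s: "push_state s \<and> fst s 3 = 1 \<and> fst s 4 = 0"
  show "runs (Seq (While rows_left (push_body r)) (Seq restart (Seq (While rows_left mark_body)
     (Seq (Assign 0 (Const 0)) (Seq restart (While rows_left write_body)))))) s
     (90 * max_steps + 12) (\<lambda>s'. \<exists>ow. assigned ow \<and> output_of s' = rows_upto ow (m + 1) 0)"
  proof (rule runs_Seq)
    show "runs (While rows_left (push_body r)) s (30 * max_steps + 1)
        (\<lambda>s'. push_state s' \<and> fst s' 3 = m + 1)"
      using s runs_push by blast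
  next
    fix s assume s: "push_state s \<and> fst s 3 = m + 1"
    define ow where "ow = snd s 3"
    have inv: "push_inv (m + 1) (fst s 4) (snd s 1) (snd s 2) ow (snd s 4)"
      using s unfolding push_state_def ow_def by metis
    have ow: "assigned ow" by (rule push_inv_assigned[OF inv])
    show "runs (Seq restart (Seq (While rows_left mark_body)
       (Seq (Assign 0 (Const 0)) (Seq restart (While rows_left write_body))))) s
       (60 * max_steps + 11) (\<lambda>s'. \<exists>ow. assigned ow \<and> output_of s' = rows_upto ow (m + 1) 0)"
    proof (rule runs_Seq)
      have "mark_state ow (sem restart s)"
        using s mark_inv_init[OF inv]
        by (cases s) (simp add: push_state_def mark_state_def base_state_def restart_sem ow_def)
      then show "runs restart s 4 (\<lambda>s. mark_state ow s \<and> fst s 3 = 1 \<and> fst s 4 = 0)"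
        by (cases s) (auto intro!: runs_restart simp: restart_sem)
    next
      fix s assume s: "mark_state ow s \<and> fst s 3 = 1 \<and> fst s 4 = 0"
      show "runs (Seq (While rows_left mark_body)
         (Seq (Assign 0 (Const 0)) (Seq restart (While rows_left write_body)))) s
         (60 * max_steps + 7) (\<lambda>s'. \<exists>ow. assigned ow \<and> output_of s' = rows_upto ow (m + 1) 0)"
      proof (rule runs_Seq)
        show "runs (While rows_left mark_body) s (30 * max_steps + 1)
            (\<lambda>s'. mark_state ow s' \<and> fst s' 3 = m + 1)"
          using s runs_mark[OF ow] by blast
      next
        fix s assume s: "mark_state ow s \<and> fst s 3 = m + 1"
        then have marked: "m < snd s 1 c \<longleftrightarrow> reach ow c" if "c \<in> {1..m}" for c
          using mark_inv_reach[OF _ ow that] by (auto simp: mark_state_def)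
        let ?s = "sem (Assign 0 (Const 0)) s"
        show "runs (Seq (Assign 0 (Const 0)) (Seq restart (While rows_left write_body))) s
           (30 * max_steps + 6) (\<lambda>s'. \<exists>ow. assigned ow \<and> output_of s' = rows_upto ow (m + 1) 0)"
        proof (rule runs_Seq)
          show "runs (Assign 0 (Const 0)) s 1 (\<lambda>s'. s' = ?s)" by (rule runs_loop_free) auto
        next
          fix s' assume s': "s' = ?s"
          show "runs (Seq restart (While rows_left write_body)) s' (30 * max_steps + 5)
             (\<lambda>s'. \<exists>ow. assigned ow \<and> output_of s' = rows_upto ow (m + 1) 0)"
          proof (rule runs_Seq)
            have "write_state ow (sem restart s')"
              using s marked unfolding s'
              by (cases s) (auto simp: write_state_def mark_state_def base_state_def restart_sem
                output_of_def rows_upto_def)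
            then show "runs restart s' 4 (\<lambda>s. write_state ow s \<and> fst s 3 = 1 \<and> fst s 4 = 0)"
              by (cases s') (auto intro!: runs_restart simp: restart_sem)
          next
            fix s assume "write_state ow s \<and> fst s 3 = 1 \<and> fst s 4 = 0"
            then show "runs (While rows_left write_body) s (30 * max_steps + 1)
               (\<lambda>s'. \<exists>ow. assigned ow \<and> output_of s' = rows_upto ow (m + 1) 0)"
              using runs_write ow unfolding runs_def by blast
          qed simp
        qed simp
      qed simp
    qed simp
  qed simp
qed simp

section \<open>The output as an encoded star matching\<close>

lemma length_rows: "length (rows_upto ow (m + 1) 0) = m * n"
  by (simp add: rows_upto_def length_concat comp_def sum_list_triv)

text \<open>Transports the owner array along the enumerations. Minimality of \<open>Z\<close> comes
  from induction on \<open>reach\<close>.\<close>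

lemma assignment_of_owners:
  fixes E :: "'a set set"
  assumes graph: "bipartite_graph (set xs) (set ys) E" and xs: "distinct xs" "length xs = m"
    and ys: "distinct ys" "length ys = n" and ow: "assigned ow"
    and adj: "\<And>c y. c \<in> {1..m} \<Longrightarrow> y < n \<Longrightarrow> adj c y \<longleftrightarrow> {xs ! (c - 1), ys ! y} \<in> E"
  shows "\<exists>L Z. assignment r (set xs) (set ys) E L Z \<and>
    rows_upto ow (m + 1) 0 = encode_stars xs ys (assignment.stars (set xs) L Z)"
proof -
  define f where "f c = xs ! (c - 1)" for c
  define g where "g y = ys ! y" for y
  \<comment> \<open>Truncated subtraction gives \<open>f 0 = f 1\<close>; the guard keeps unowned
    vertices from being credited to the first left vertex.\<close>
  define L where "L x = {g y | y. y < n \<and> ow y \<noteq> 0 \<and> f (ow y) = x}" for x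
  define Z where "Z = f ` {c. reach ow c}"
  have f_inj: "f c = f c' \<longleftrightarrow> c = c'" if "c \<in> {1..m}" "c' \<in> {1..m}" for c c'
    using that xs by (auto simp: f_def nth_eq_iff_index_eq)
  have g_inj: "g y = g y' \<longleftrightarrow> y = y'" if "y < n" "y' < n" for y y'
    using that ys by (auto simp: g_def nth_eq_iff_index_eq)
  have X: "set xs = f ` {1..m}"
  proof -
    have "x \<in> f ` {1..m}" if "x \<in> set xs" for x
    proof -
      from that obtain i where "i < m" "x = xs ! i" using xs by (metis in_set_conv_nth)
      then have "x = f (Suc i)" "Suc i \<in> {1..m}" by (auto simp: f_def)
      then show ?thesis by blast
    qed
    then show ?thesis using xs by (auto simp: f_def)
  qed
  have Y: "set ys = g ` {..<n}"
    using ys by (auto simp: g_def in_set_conv_nth)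
  have adj: "adj c y \<longleftrightarrow> {f c, g y} \<in> E" if "c \<in> {1..m}" "y < n" for c y
    using adj[OF that] by (simp add: f_def g_def)
  have ow_range: "ow y \<in> {1..m} \<and> {f (ow y), g y} \<in> E" if "y < n" "ow y \<noteq> 0" for y
    using ow that adj[of "ow y" y] by (auto simp: assigned_def)
  have L_f: "L (f c) = g ` owned ow c" if "c \<in> {1..m}" for c
    using that f_inj ow_range by (auto simp: L_def owned_def)
  have L_card: "card (L (f c)) = card (owned ow c)" if "c \<in> {1..m}" for c
    using that g_inj by (simp add: L_f) (intro card_image inj_onI, auto simp: owned_def)
  have reach_range: "c \<in> {1..m}" if "reach ow c" for c using ow that by (auto simp: assigned_def)
  have Z_f: "f c \<in> Z \<longleftrightarrow> reach ow c" if "c \<in> {1..m}" for c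
    using that f_inj reach_range by (auto simp: Z_def)
  have "assignment r (set xs) (set ys) E L Z"
  proof
    show "bipartite_graph (set xs) (set ys) E" by (rule graph)
    show "L x \<subseteq> nbhd (set ys) E {x}" for x
      using ow_range by (auto simp: L_def nbhd_def Y)
    show "card (L x) \<le> r" if "x \<in> set xs" for x
      using that ow by (auto simp: X L_card assigned_def)
    show "L x \<inter> L x' = {}" if "x \<noteq> x'" for x x'
      using that g_inj by (auto simp: L_def)
    show "Z \<subseteq> set xs" using reach_range by (auto simp: Z_def X)
    show "x \<in> Z" if "x \<in> set xs" "card (L x) < r" for x
      using that reach.deficient[of _ ow] by (auto simp: X L_card Z_f)
    show "nbhd (set ys) E Z \<subseteq> \<Union> (L ` Z)"
    proof
      fix v assume "v \<in> nbhd (set ys) E Z"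
      then obtain c y where c: "reach ow c" "{f c, g y} \<in> E" and y: "v = g y" "y < n"
        by (auto simp: nbhd_def Z_def Y)
      then have "reach ow (ow y)" using adj reach_range by (auto intro: reach.step)
      then have "f (ow y) \<in> Z" "v \<in> L (f (ow y))"
        using y reach_range[of "ow y"] by (auto simp: Z_def L_def)
      then show "v \<in> \<Union> (L ` Z)" by blast
    qed
    show "W = Z" if W: "W \<subseteq> Z" and def: "\<And>x. x \<in> Z \<Longrightarrow> card (L x) < r \<Longrightarrow> x \<in> W"
      and closed: "nbhd (set ys) E W \<subseteq> \<Union> (L ` W)" for W
    proof -
      have "f c \<in> W" if "reach ow c" for c
        using that
      proof induction
        case (deficient c)
        then show ?case using def[of "f c"] Z_f L_card reach.deficient by auto
      next
        case (step c y)
        then have "g y \<in> nbhd (set ys) E W"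
          using adj reach_range[of c] by (auto simp: nbhd_def Y)
        then obtain x where "x \<in> W" "g y \<in> L x" using closed by blast
        then show ?case using g_inj step by (auto simp: L_def)
      qed
      then show ?thesis using W by (auto simp: Z_def)
    qed
  qed
  then interpret assignment r "set xs" "set ys" E L Z .
  have "(\<exists>S. (f c, S) \<in> stars \<and> g y \<in> S) \<longleftrightarrow> result ow c y" if "c \<in> {1..m}" "y < n" for c y
  proof -
    have "f c \<in> set xs" using that X by blast
    then have "(\<exists>S. (f c, S) \<in> stars \<and> g y \<in> S) \<longleftrightarrow> f c \<notin> Z \<and> g y \<in> L (f c)"
      by (auto simp: stars_def)
    also have "\<dots> \<longleftrightarrow> result ow c y"
      using that g_inj by (auto simp: result_def L_f Z_f owned_def)
    finally show ?thesis .
  qed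
  then have "rows_upto ow (m + 1) 0 =
      concat (map (\<lambda>c. map (\<lambda>y. \<exists>S. (f c, S) \<in> stars \<and> g y \<in> S) [0..<n]) [1..<m + 1])"
    unfolding rows_upto_def by (auto intro!: arg_cong[where f = concat])
  also have "\<dots> = encode_stars (map f [1..<m + 1]) (map g [0..<n]) stars"
    by (simp add: encode_stars_def matrix_bits_def comp_def del: upt_Suc)
  also have "map f [1..<m + 1] = xs" using xs by (intro nth_equalityI) (auto simp: f_def simp del: upt_Suc)
  also have "map g [0..<n] = ys" using ys map_nth[of ys] by (simp add: g_def[abs_def])
  finally have "rows_upto ow (m + 1) 0 = encode_stars xs ys stars" .
  then show ?thesis using assignment_axioms by blast
qed

end

section \<open>Parsing the input\<close>

lemma matrix_bits_nth:
  "i < length xs \<Longrightarrow> k < length ys \<Longrightarrow> matrix_bits xs ys R ! (i * length ys + k) = R (xs ! i) (ys ! k)"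
proof (induction xs arbitrary: i)
  case (Cons x xs)
  then show ?case by (cases i) (auto simp: matrix_bits_def nth_append)
qed simp

lemma length_matrix_bits: "length (matrix_bits xs ys R) = length xs * length ys"
  by (simp add: matrix_bits_def length_concat comp_def sum_list_triv)

definition input_bit :: "bool list \<Rightarrow> nat \<Rightarrow> nat" where
  "input_bit w i = (if i < length w \<and> w ! i then 1 else 0)"

text \<open>Covers malformed inputs as well: cells past the end read as 0, so both unary counts stop
  by the end of the input at the latest.\<close>

definition header :: "bool list \<Rightarrow> nat \<Rightarrow> nat \<Rightarrow> bool" where
  "header w m n \<longleftrightarrow> m \<le> length w \<and> n \<le> length w \<and>
     (\<forall>i<m. input_bit w i \<noteq> 0) \<and> input_bit w m = 0 \<and>
     (\<forall>i<n. input_bit w (m + 1 + i) \<noteq> 0) \<and> input_bit w (m + 1 + n) = 0"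

lemma runs_parse:
  "runs parse (input_state w) (6 * length w + 2)
     (\<lambda>s. snd s = snd (input_state w) \<and> header w (fst s 1) (fst s 2))"
  unfolding parse_def
proof (rule runs_Seq)
  let ?P = "\<lambda>s :: state. snd s = snd (input_state w) \<and> fst s 2 = 0 \<and> fst s 1 \<le> length w \<and>
     (\<forall>i<fst s 1. input_bit w i \<noteq> 0)"
  show "runs (While (Read 0 (Var 1)) (incr 1)) (input_state w) (2 * length w + 1)
     (\<lambda>s. ?P s \<and> input_bit w (fst s 1) = 0)"
    by (rule runs_While[where \<mu> = "\<lambda>s. length w - fst s 1" and I = ?P])
      (auto simp: incr_def input_state_def input_bit_def less_Suc_eq split: if_splits)
next
  fix s :: state assume s: "(snd s = snd (input_state w) \<and> fst s 2 = 0 \<and> fst s 1 \<le> length w \<and>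
     (\<forall>i<fst s 1. input_bit w i \<noteq> 0)) \<and> input_bit w (fst s 1) = 0"
  let ?P = "\<lambda>s' :: state. snd s' = snd (input_state w) \<and> fst s' 1 = fst s 1 \<and> fst s' 2 \<le> length w \<and>
     (\<forall>i<fst s' 2. input_bit w (fst s 1 + 1 + i) \<noteq> 0)"
  show "runs (While (Read 0 (Add (Add (Var 1) (Const 1)) (Var 2))) (incr 2)) s (2 * length w + 1)
     (\<lambda>s. snd s = snd (input_state w) \<and> header w (fst s 1) (fst s 2))"
    by (rule runs_While[where \<mu> = "\<lambda>s. length w - fst s 2" and I = ?P])
      (use s in \<open>auto simp: incr_def input_state_def input_bit_def header_def less_Suc_eq split: if_splits\<close>)
qed simp

lemma header_encode_graph:
  assumes "header (encode_graph xs ys E) m n"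
  shows "m = length xs" and "n = length ys"
proof -
  let ?w = "encode_graph xs ys E"
  have 1: "input_bit ?w i = 1" if "i < length xs" for i
    using that by (simp add: input_bit_def encode_graph_def nth_append)
  have 2: "input_bit ?w (length xs) = 0"
    by (simp add: input_bit_def encode_graph_def nth_append)
  have 3: "input_bit ?w (length xs + 1 + i) = 1" if "i < length ys" for i
    using that by (simp add: input_bit_def encode_graph_def nth_append)
  have 4: "input_bit ?w (length xs + 1 + length ys) = 0"
    by (simp add: input_bit_def encode_graph_def nth_append)
  show m: "m = length xs"
    using assms 1[of m] 2 by (cases m "length xs" rule: linorder_cases) (auto simp: header_def)
  show "n = length ys"
    using assms 3[of n] 4 unfolding m
    by (cases n "length ys" rule: linorder_cases) (auto simp: header_def)
qed

lemma input_bit_encode_graph: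
  assumes "c \<in> {1..length xs}" and "y < length ys"
  shows "input_bit (encode_graph xs ys E) (length xs + 2 + c * length ys + y) \<noteq> 0 \<longleftrightarrow>
    {xs ! (c - 1), ys ! y} \<in> E"
proof -
  obtain i where c: "c = Suc i" and i: "i < length xs" using assms by (cases c) auto
  have "i * length ys + y < length xs * length ys"
  proof -
    have "i * length ys + y < Suc i * length ys" using assms by simp
    also have "\<dots> \<le> length xs * length ys" using i by (intro mult_right_mono) auto
    finally show ?thesis .
  qed
  then show ?thesis
    using matrix_bits_nth[OF i assms(2)]
    by (simp add: input_bit_def encode_graph_def nth_append c length_matrix_bits)
qed

text \<open>A relation, since the final owner array need not be known explicitly. It makes sense for
  every bit string, as \<open>polytime\<close> demands; optimality follows on encoded
  graphs.\<close>

definition solves :: "nat \<Rightarrow> bool list \<Rightarrow> bool list \<Rightarrow> bool" where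
  "solves r w u \<longleftrightarrow> (\<exists>m n ow. header w m n \<and> auction.assigned r m n (input_bit w) ow \<and>
     u = auction.rows_upto r m n (input_bit w) ow (m + 1) 0)"

text \<open>The last summand \<open>N * N\<close> pays for the length of the output.\<close>

definition time_bound :: "nat \<Rightarrow> nat" where
  "time_bound N = 6 * N + 18 + 90 * (((N + N) * (N + 1) * (N + 1) + N) * (N + 1) + N) + N * N"

lemma runs_program:
  "runs (Seq parse (solve r)) (input_state w) (time_bound (length w) - length w * length w)
     (\<lambda>s. solves r w (output_of s))"
proof (rule runs_Seq[OF runs_parse])
  fix s :: state assume s: "snd s = snd (input_state w) \<and> header w (fst s 1) (fst s 2)"
  let ?m = "fst s 1" and ?n = "fst s 2" and ?N = "length w"
  have le: "?m \<le> ?N" "?n \<le> ?N" using s by (auto simp: header_def)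
  have "auction.max_steps ?m ?n \<le> ((?N + ?N) * (?N + 1) * (?N + 1) + ?N) * (?N + 1) + ?N"
    unfolding auction.max_steps_def using le by (intro add_mono mult_mono) auto
  then have T: "90 * auction.max_steps ?m ?n + 16 \<le> time_bound ?N - ?N * ?N - (6 * ?N + 2)"
    by (simp add: time_bound_def)
  have b: "snd s 0 = input_bit w"
    and zero: "\<And>k. k \<in> {1..4} \<Longrightarrow> snd s k = (\<lambda>_. 0)"
    using s by (auto simp: input_state_def input_bit_def)
  from auction.runs_solve[OF refl refl b zero, of r]
  show "runs (solve r) s (time_bound ?N - ?N * ?N - (6 * ?N + 2)) (\<lambda>s. solves r w (output_of s))"
    using T s unfolding runs_def solves_def by (meson le_trans)
qed (simp add: time_bound_def)

lemma length_solves: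
  assumes "solves r w u"
  shows "length u \<le> length w * length w"
proof -
  from assms obtain m n ow where "header w m n" "u = auction.rows_upto r m n (input_bit w) ow (m + 1) 0"
    by (auto simp: solves_def)
  then show ?thesis unfolding header_def by (metis auction.length_rows mult_le_mono)
qed

text \<open>The function is obtained by choosing a halting run for each input; the time bound is
  then rewritten as a polynomial in the indeterminate \<open>x\<close>.\<close>

lemma polytime_solves: "\<exists>f. polytime f \<and> (\<forall>w. solves r w (f w))"
proof -
  have "\<exists>t s. exec (Seq parse (solve r)) (input_state w) t s \<and> solves r w (output_of s) \<and>
      t + length (output_of s) \<le> time_bound (length w)" for w
  proof -
    obtain t s where ts: "exec (Seq parse (solve r)) (input_state w) t s"
      "t \<le> time_bound (length w) - length w * length w" "solves r w (output_of s)"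
      using runs_program[of r w] unfolding runs_def by blast
    then have "t + length (output_of s) \<le> time_bound (length w)"
      using length_solves[OF ts(3)] by (simp add: time_bound_def)
    with ts show ?thesis by blast
  qed
  then obtain t s where ts: "\<And>w. exec (Seq parse (solve r)) (input_state w) (t w) (s w)"
    "\<And>w. solves r w (output_of (s w))" "\<And>w. t w + length (output_of (s w)) \<le> time_bound (length w)"
    by metis
  define x :: "nat poly" where "x = [:0, 1:]"
  define q where "q = 6 * x + 18 + 90 * (((x + x) * (x + 1) * (x + 1) + x) * (x + 1) + x) + x * x"
  have "poly q N = time_bound N" for N
    unfolding q_def time_bound_def
    by (simp only: poly_add poly_mult poly_numeral poly_1 x_def poly_pCons poly_0 mult_zero_right
      add_0_left add_0_right mult_1_right)
  then have "polytime (\<lambda>w. output_of (s w))"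
    unfolding polytime_def using ts by metis
  with ts show ?thesis by blast
qed

lemma solves_encode_graph:
  assumes "solves r (encode_graph xs ys E) u" and "bipartite_graph (set xs) (set ys) E"
    and "distinct xs" and "distinct ys"
  shows "\<exists>L Z. assignment r (set xs) (set ys) E L Z \<and>
    u = encode_stars xs ys (assignment.stars (set xs) L Z)"
proof -
  let ?w = "encode_graph xs ys E"
  obtain m n ow where *: "header ?w m n" "auction.assigned r m n (input_bit ?w) ow"
    "u = auction.rows_upto r m n (input_bit ?w) ow (m + 1) 0"
    using assms(1) by (auto simp: solves_def)
  note len = header_encode_graph[OF *(1)]
  have "auction.adj m n (input_bit ?w) c y \<longleftrightarrow> {xs ! (c - 1), ys ! y} \<in> E"
    if "c \<in> {1..m}" "y < n" for c y
    using input_bit_encode_graph[of c xs y ys E] that by (simp add: auction.adj_def len)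
  then show ?thesis
    unfolding *(3) using assms(2-) *(2) len by (intro auction.assignment_of_owners) simp_all
qed

theorem theorem5p1:
  fixes r :: nat
  assumes "r \<ge> 1"
  shows
    "(\<exists>f. polytime f \<and>
        (\<forall>X Y (E :: 'a set set) xs ys.
           bipartite_graph X Y E \<and> distinct xs \<and> set xs = X \<and> distinct ys \<and> set ys = Y \<longrightarrow>
           (\<exists>M. maximum_envy_free_star_matching r X Y E M \<and>
                f (encode_graph xs ys E) = encode_stars xs ys M))) \<and>
     (\<forall>X Y (E :: 'a set set).
        bipartite_graph X Y E \<and> card (nbhd Y E X) \<ge> r * card X \<and> r * card X \<ge> 1 \<longrightarrow>
        (\<exists>M. envy_free_star_matching r X Y E M \<and> M \<noteq> {}))"
proof (rule conjI)
  obtain f where f: "polytime f" "\<And>w. solves r w (f w)" using polytime_solves by blast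
  note sol = solves_encode_graph[OF f(2)]
  show "\<exists>f. polytime f \<and>
        (\<forall>X Y (E :: 'a set set) xs ys.
           bipartite_graph X Y E \<and> distinct xs \<and> set xs = X \<and> distinct ys \<and> set ys = Y \<longrightarrow>
           (\<exists>M. maximum_envy_free_star_matching r X Y E M \<and>
                f (encode_graph xs ys E) = encode_stars xs ys M))"
    using f(1) sol assignment.stars_maximum by metis
  show "\<forall>X Y (E :: 'a set set).
        bipartite_graph X Y E \<and> card (nbhd Y E X) \<ge> r * card X \<and> r * card X \<ge> 1 \<longrightarrow>
        (\<exists>M. envy_free_star_matching r X Y E M \<and> M \<noteq> {})"
  proof (intro allI impI, elim conjE)
    fix X Y and E :: "'a set set"
    assume graph: "bipartite_graph X Y E" and *: "r * card X \<le> card (nbhd Y E X)" "1 \<le> r * card X"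
    then obtain xs ys where "set xs = X" "distinct xs" "set ys = Y" "distinct ys"
      by (metis bipartite_graph_def finite_distinct_list)
    \<comment> \<open>Existence of the assignment is itself read off the output of the
      algorithm.\<close>
    then obtain L Z where "assignment r X Y E L Z" using sol graph by metis
    then show "\<exists>M. envy_free_star_matching r X Y E M \<and> M \<noteq> {}"
      using assignment.stars_envy_free assignment.stars_nonempty * by metis
  qed
qed

end
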